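(* Let $\Omega=\mathbb{R}^d$ be equipped with the distance of an $\ell_m$ norm, $m\ge1$, let $p\ge1$, $\alpha\in(0,1)$, and let $(\mathcal{X}\times\Omega,d_{\mathcal{X}},\mu_0)$ and $(\mathcal{Y}\times\Omega,d_{\mathcal{Y}},\mu_1)$ be in $\mathbb{S}_p(\mathbb{R}^d)$. Let $\pi^*$ be an optimal coupling for the Fused Gromov-Wasserstein distance $FGW_{\alpha,p,1}$ between $\mu_0$ and $\mu_1$. For $t\in[0,1]$ define $\eta_t:\mathcal{X}\times\Omega\times\mathcal{Y}\times\Omega\to\mathcal{X}\times\mathcal{Y}\times\Omega$ by $$\eta_t(x,\mathbf{a},y,\mathbf{b})=(x,y,(1-t)\mathbf{a}+t\mathbf{b}).$$ Then $$\Big(\mathcal{X}\times\mathcal{Y}\times\Omega,\ (1-t)d_{\mathcal{X}}\oplus t\,d_{\mathcal{Y}},\ \mu_t=\eta_t\#\pi^*\Big)_{t\in[0,1]}$$ is a constant speed geodesic connecting $(\mathcal{X}\times\Omega,d_{\mathcal{X}},\mu_0)$ and $(\mathcal{Y}\times\Omega,d_{\mathcal{Y}},\mu_1)$ in the metric space $\big(\mathbb{S}_p(\mathbb{R}^d),FGW_{\alpha,p,1}\big)$.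
   Context: Metric spaces are complete and separable. A structured object over $(\Omega,d)$ is a triplet $(\mathcal{X}\times\Omega,d_{\mathcal{X}},\mu)$ with $(\mathcal{X},d_{\mathcal{X}})$ a metric space (the structure space) and $\mu$ a Borel probability measure on $\mathcal{X}\times\Omega$, with marginals $\mu_X,\mu_A$. It is in $\mathbb{S}_p(\Omega)$ if $\int d(a,a_0)^p d\mu_A<\infty$ for some $a_0$ and $\iint d_{\mathcal{X}}(x,x')^p d\mu_X d\mu_X<\infty$. $$FGW_{\alpha,p,1}(\mu,\nu)=\Big(\inf_{\pi\in\Pi(\mu,\nu)}\iint\big((1-\alpha)d(a,b)+\alpha|d_{\mathcal{X}}(x,x')-d_{\mathcal{Y}}(y,y')|\big)^p d\pi((x,a),(y,b))d\pi((x',a'),(y',b'))\Big)^{1/p}.$$ Structured objects are identified when their $FGW$ distance is zero (at $t=0,1$ the structure function below is only a pseudo-metric; the same formula for $FGW$ is used). Here the structure space at time $t$ is $\mathcal{X}\times\mathcal{Y}$ with $\big((1-t)d_{\mathcal{X}}\oplus td_{\mathcal{Y}}\big)((x,y),(x',y'))=(1-t)d_{\mathcal{X}}(x,x')+t\,d_{\mathcal{Y}}(y,y')$, and $\#$ is push-forward. A curve $w:[0,1]\to(S,\mathrm{dist})$ joining $u=w(0)$ and $v=w(1)$ is a constant speed geodesic if $\mathrm{dist}(w(t),w(s))\le|t-s|\,\mathrm{dist}(u,v)$ for all $s,t\in[0,1]$ (equivalently, by the triangle inequality, with equality). *)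

theory Defs
  imports "HOL-Probability.Probability"
begin

text \<open>
  A structured object over a feature space \<open>'w\<close> is a pair of a distance function on the structure
  space \<open>'x\<close> and a measure on \<open>'x \<times> 'w\<close>. The structure distance is explicit data, because the
  space \<open>'x \<times> 'y\<close> carries a different distance at each time of the curve. The topology of the type
  is only used for the Borel sets.
\<close>

type_synonym ('x, 'w) struct_obj = "('x \<Rightarrow> 'x \<Rightarrow> real) \<times> ('x \<times> 'w) measure"

text \<open>
  Separability is provided by the sort, as a metrizable topology is separable iff it is
  second countable.
\<close>

definition polish_metric :: "('x::second_countable_topology \<Rightarrow> 'x \<Rightarrow> real) \<Rightarrow> bool" where
  "polish_metric dX \<longleftrightarrow>
     Metric_space UNIV dX \<and>
     Metric_space.mtopology UNIV dX = euclidean \<and>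
     Metric_space.mcomplete UNIV dX"

definition cont_pseudo_metric :: "('x::topological_space \<Rightarrow> 'x \<Rightarrow> real) \<Rightarrow> bool" where
  "cont_pseudo_metric dX \<longleftrightarrow>
     (\<forall>x. dX x x = 0) \<and> (\<forall>x y. 0 \<le> dX x y) \<and> (\<forall>x y. dX x y = dX y x) \<and>
     (\<forall>x y z. dX x z \<le> dX x y + dX y z) \<and>
     continuous_on UNIV (\<lambda>(x, y). dX x y)"

definition borel_prob :: "'z::topological_space measure \<Rightarrow> bool" where
  "borel_prob \<mu> \<longleftrightarrow> prob_space \<mu> \<and> sets \<mu> = sets borel"

definition struct_marginal :: "('x::topological_space \<times> 'w::topological_space) measure \<Rightarrow> 'x measure"
  where "struct_marginal \<mu> = distr \<mu> borel fst"

definition feature_marginal :: "('x::topological_space \<times> 'w::topological_space) measure \<Rightarrow> 'w measure"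
  where "feature_marginal \<mu> = distr \<mu> borel snd"

definition finite_moments ::
  "('w \<Rightarrow> 'w \<Rightarrow> real) \<Rightarrow> real \<Rightarrow>
     ('x::topological_space, 'w::topological_space) struct_obj \<Rightarrow> bool" where
  "finite_moments d p = (\<lambda>(dX, \<mu>).
     (\<exists>a0. (\<integral>\<^sup>+ a. ennreal (d a a0 powr p) \<partial>feature_marginal \<mu>) < \<infinity>) \<and>
     (\<integral>\<^sup>+ x. (\<integral>\<^sup>+ x'. ennreal (dX x x' powr p) \<partial>struct_marginal \<mu>) \<partial>struct_marginal \<mu>) < \<infinity>)"

definition struct_space ::
  "('w \<Rightarrow> 'w \<Rightarrow> real) \<Rightarrow> real \<Rightarrow>
     ('x::second_countable_topology, 'w::second_countable_topology) struct_obj set" where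
  "struct_space d p =
     {(dX, \<mu>). polish_metric dX \<and> borel_prob \<mu> \<and> finite_moments d p (dX, \<mu>)}"

text \<open>
  The endpoints of the curve only carry a pseudo-metric. They stand for the elements of
  \<^const>\<open>struct_space\<close> from which they have vanishing Fused Gromov-Wasserstein distance.
\<close>

definition pseudo_struct_space ::
  "('w \<Rightarrow> 'w \<Rightarrow> real) \<Rightarrow> real \<Rightarrow>
     ('x::second_countable_topology, 'w::second_countable_topology) struct_obj set" where
  "pseudo_struct_space d p =
     {(dX, \<mu>). cont_pseudo_metric dX \<and> borel_prob \<mu> \<and> finite_moments d p (dX, \<mu>)}"

definition couplings ::
  "'a::topological_space measure \<Rightarrow> 'b::topological_space measure \<Rightarrow> ('a \<times> 'b) measure set" where
  "couplings \<mu> \<nu> = {\<pi>. borel_prob \<pi> \<and> distr \<pi> borel fst = \<mu> \<and> distr \<pi> borel snd = \<nu>}"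

definition fgw_cost ::
  "('w \<Rightarrow> 'w \<Rightarrow> real) \<Rightarrow> real \<Rightarrow> real \<Rightarrow> ('x \<Rightarrow> 'x \<Rightarrow> real) \<Rightarrow> ('y \<Rightarrow> 'y \<Rightarrow> real) \<Rightarrow>
     (('x \<times> 'w) \<times> ('y \<times> 'w)) measure \<Rightarrow> ennreal" where
  "fgw_cost d \<alpha> p dX dY \<pi> =
     (\<integral>\<^sup>+ ((x, a), (y, b)). (\<integral>\<^sup>+ ((x', a'), (y', b')).
        ennreal (((1 - \<alpha>) * d a b + \<alpha> * \<bar>dX x x' - dY y y'\<bar>) powr p) \<partial>\<pi>) \<partial>\<pi>)"

text \<open>The \<open>p\<close>-th root, with the convention that it maps \<open>\<infinity>\<close> to \<open>\<infinity>\<close>.\<close>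

definition ennreal_root :: "real \<Rightarrow> ennreal \<Rightarrow> ennreal" where
  "ennreal_root p v = (if v = \<infinity> then \<infinity> else ennreal (enn2real v powr (1 / p)))"

definition FGW ::
  "('w \<Rightarrow> 'w \<Rightarrow> real) \<Rightarrow> real \<Rightarrow> real \<Rightarrow>
     ('x::topological_space, 'w::topological_space) struct_obj \<Rightarrow>
     ('y::topological_space, 'w) struct_obj \<Rightarrow> ennreal" where
  "FGW d \<alpha> p = (\<lambda>(dX, \<mu>) (dY, \<nu>).
     ennreal_root p (INF \<pi>\<in>couplings \<mu> \<nu>. fgw_cost d \<alpha> p dX dY \<pi>))"

definition optimal_coupling ::
  "('w \<Rightarrow> 'w \<Rightarrow> real) \<Rightarrow> real \<Rightarrow> real \<Rightarrow>
     ('x::topological_space, 'w::topological_space) struct_obj \<Rightarrow>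
     ('y::topological_space, 'w) struct_obj \<Rightarrow> (('x \<times> 'w) \<times> ('y \<times> 'w)) measure \<Rightarrow> bool" where
  "optimal_coupling d \<alpha> p = (\<lambda>(dX, \<mu>) (dY, \<nu>) \<pi>.
     \<pi> \<in> couplings \<mu> \<nu> \<and>
     (\<forall>\<pi>'\<in>couplings \<mu> \<nu>. fgw_cost d \<alpha> p dX dY \<pi> \<le> fgw_cost d \<alpha> p dX dY \<pi>'))"

text \<open>
  Objects at vanishing distance are identified, so the endpoint conditions \<open>w 0 = u\<close> and \<open>w 1 = v\<close>
  say that the distances vanish. The curve and its endpoints may live over different structure
  spaces.
\<close>

definition FGW_constant_speed_geodesic ::
  "('w \<Rightarrow> 'w \<Rightarrow> real) \<Rightarrow> real \<Rightarrow> real \<Rightarrow>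
     (real \<Rightarrow> ('z::topological_space, 'w::topological_space) struct_obj) \<Rightarrow>
     ('x::topological_space, 'w) struct_obj \<Rightarrow> ('y::topological_space, 'w) struct_obj \<Rightarrow> bool" where
  "FGW_constant_speed_geodesic d \<alpha> p w u v \<longleftrightarrow>
     FGW d \<alpha> p (w 0) u = 0 \<and> FGW d \<alpha> p (w 1) v = 0 \<and>
     (\<forall>s\<in>{0..1}. \<forall>t\<in>{0..1}.
        FGW d \<alpha> p (w t) (w s) \<le> ennreal \<bar>t - s\<bar> * FGW d \<alpha> p u v)"

definition lm_dist :: "real \<Rightarrow> real ^ 'n \<Rightarrow> real ^ 'n \<Rightarrow> real" where
  "lm_dist m a b = (\<Sum>i\<in>UNIV. \<bar>a $ i - b $ i\<bar> powr m) powr (1 / m)"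

definition interp_dist ::
  "('x \<Rightarrow> 'x \<Rightarrow> real) \<Rightarrow> ('y \<Rightarrow> 'y \<Rightarrow> real) \<Rightarrow> real \<Rightarrow> 'x \<times> 'y \<Rightarrow> 'x \<times> 'y \<Rightarrow> real" where
  "interp_dist dX dY t = (\<lambda>(x, y) (x', y'). (1 - t) * dX x x' + t * dY y y')"

definition interp_map ::
  "real \<Rightarrow> ('x \<times> 'w::real_vector) \<times> ('y \<times> 'w) \<Rightarrow> ('x \<times> 'y) \<times> 'w" where
  "interp_map t = (\<lambda>((x, a), (y, b)). ((x, y), (1 - t) *\<^sub>R a + t *\<^sub>R b))"

definition interp_obj ::
  "('x::topological_space \<Rightarrow> 'x \<Rightarrow> real) \<Rightarrow> ('y::topological_space \<Rightarrow> 'y \<Rightarrow> real) \<Rightarrow>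
     (('x \<times> 'w) \<times> ('y \<times> 'w::real_normed_vector)) measure \<Rightarrow>
     real \<Rightarrow> ('x \<times> 'y, 'w) struct_obj" where
  "interp_obj dX dY \<pi> t = (interp_dist dX dY t, distr \<pi> borel (interp_map t))"

end

theory Submission
  imports Defs
begin

text \<open>
  The push-forward of the optimal coupling \<open>\<pi>\<close> under \<open>z \<mapsto> (\<eta>\<^sub>t z, \<eta>\<^sub>s z)\<close> is a coupling of \<open>\<mu>\<^sub>t\<close> and \<open>\<mu>\<^sub>s\<close>.
  In its cost, both the feature distance and the distortion of the structure distances are
  those of \<open>\<pi>\<close> scaled by \<open>\<bar>t - s\<bar>\<close>, so the cost is exactly \<open>\<bar>t - s\<bar>\<^sup>p\<close> times that of \<open>\<pi>\<close>.
  At the endpoints, \<open>\<pi>\<close> transported to the graph of the projection has cost zero.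
\<close>

section \<open>Projections and Borel sets of product types\<close>

lemma borel_measurable_fst:
  "(fst :: 'a::topological_space \<times> 'b::topological_space \<Rightarrow> 'a) \<in> borel \<rightarrow>\<^sub>M borel"
  by (intro borel_measurable_continuous_onI continuous_intros)

lemma borel_measurable_snd:
  "(snd :: 'a::topological_space \<times> 'b::topological_space \<Rightarrow> 'b) \<in> borel \<rightarrow>\<^sub>M borel"
  by (intro borel_measurable_continuous_onI continuous_intros)

text \<open>Measures on pairs are taken here on \<open>borel\<close> of the product type, so
  measurability of the coordinates comes from continuity of the projections; this form feeds it to
  the \<open>measurable\<close> method.\<close>

lemmas borel_measurable_projections [measurable (raw)] =
  measurable_compose[OF _ borel_measurable_fst] measurable_compose[OF _ borel_measurable_snd]

section \<open>Continuous pseudo-metrics and their interpolation\<close>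

lemma cont_pseudo_metricD:
  assumes "cont_pseudo_metric d"
  shows "d x x = 0" "0 \<le> d x y" "d x y = d y x" "d x z \<le> d x y + d y z"
    and "continuous_on UNIV (\<lambda>(x, y). d x y)"
  using assms unfolding cont_pseudo_metric_def by blast+

text \<open>A distance is jointly continuous for the topology it induces, and that topology is the
  one of the type.\<close>

lemma polish_metric_imp_cont_pseudo_metric:
  assumes "polish_metric d"
  shows "cont_pseudo_metric d"
proof -
  have M: "Metric_space UNIV d" and top: "Metric_space.mtopology UNIV d = euclidean"
    using assms by (auto simp: polish_metric_def)
  interpret Metric_space UNIV d by (fact M)
  have top': "mtopology_of (metric (UNIV, d)) = euclidean"
    using top mtopology_of by simp
  have "continuous_map euclidean euclidean (\<lambda>z. mdist (metric (UNIV, d)) (fst z) (snd z))"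
    by (intro continuous_map_mdist) (auto simp: top intro: continuous_intros)
  then have "continuous_on UNIV (\<lambda>(x, y). d x y)"
    by (simp add: case_prod_beta')
  then show ?thesis
    using commute triangle by (auto simp: cont_pseudo_metric_def)
qed

text \<open>Second countability makes the pair of \<open>f\<close> and \<open>g\<close> Borel for
  the product topology, where the distance is continuous.\<close>

lemma borel_measurable_cont_pseudo_metric:
  fixes d :: "'a::second_countable_topology \<Rightarrow> 'a \<Rightarrow> real"
  assumes "cont_pseudo_metric d" "f \<in> M \<rightarrow>\<^sub>M borel" "g \<in> M \<rightarrow>\<^sub>M borel"
  shows "(\<lambda>z. d (f z) (g z)) \<in> borel_measurable M"
proof -
  have "(\<lambda>(x, y). d x y) \<in> borel_measurable borel"
    using cont_pseudo_metricD(5)[OF assms(1)] by (rule borel_measurable_continuous_onI)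
  from measurable_compose[OF borel_measurable_Pair[OF assms(2,3)] this] show ?thesis
    by simp
qed

text \<open>Nonnegative weights preserve every pseudo-metric axiom. At t = 0 and t = 1 one
  coordinate is ignored, so separation of points cannot be expected on the closed interval.\<close>

lemma cont_pseudo_metric_interp_dist:
  assumes X: "cont_pseudo_metric dX" and Y: "cont_pseudo_metric dY" and t: "t \<in> {0..1}"
  shows "cont_pseudo_metric (interp_dist dX dY t)"
proof -
  \<comment> \<open>Joint continuity of each distance, restated for arguments that are themselves
    continuous functions.\<close>
  note [continuous_intros] =
    continuous_on_compose2[OF cont_pseudo_metricD(5)[OF X], where f = "\<lambda>z. (f z, g z)" for f g,
      simplified]
    continuous_on_compose2[OF cont_pseudo_metricD(5)[OF Y], where f = "\<lambda>z. (f z, g z)" for f g,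
      simplified]
  have "continuous_on UNIV (\<lambda>(u, v). interp_dist dX dY t u v)"
    unfolding interp_dist_def case_prod_beta' by (intro continuous_intros)
  moreover have "interp_dist dX dY t u w \<le> interp_dist dX dY t u v + interp_dist dX dY t v w" for u v w
  proof -
    have "(1 - t) * dX (fst u) (fst w) \<le> (1 - t) * (dX (fst u) (fst v) + dX (fst v) (fst w))"
      using t by (intro mult_left_mono cont_pseudo_metricD(4)[OF X]) auto
    moreover have "t * dY (snd u) (snd w) \<le> t * (dY (snd u) (snd v) + dY (snd v) (snd w))"
      using t by (intro mult_left_mono cont_pseudo_metricD(4)[OF Y]) auto
    ultimately show ?thesis
      by (simp add: interp_dist_def case_prod_beta' algebra_simps)
  qed
  ultimately show ?thesis
    using t cont_pseudo_metricD(1-3)[OF X] cont_pseudo_metricD(1-3)[OF Y]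
    unfolding cont_pseudo_metric_def
    by (auto simp: interp_dist_def)
qed

section \<open>Complete separable metrics at interior times\<close>

lemma polish_metric_openin:
  assumes "polish_metric d"
  shows "open U \<longleftrightarrow> (\<forall>x\<in>U. \<exists>r>0. \<forall>y. d x y < r \<longrightarrow> y \<in> U)"
proof -
  interpret Metric_space UNIV d using assms by (simp add: polish_metric_def)
  have "mtopology = euclidean" using assms by (simp add: polish_metric_def)
  then have "open U \<longleftrightarrow> openin mtopology U" by simp
  then show ?thesis unfolding openin_mtopology by (auto simp: subset_iff)
qed

lemma polish_metric_Cauchy_limit:
  assumes "polish_metric d" "\<And>e. e > 0 \<Longrightarrow> \<exists>N. \<forall>n\<ge>N. \<forall>n'\<ge>N. d (\<sigma> n) (\<sigma> n') < e"
  obtains x where "\<sigma> \<longlonglongrightarrow> x"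
proof -
  interpret Metric_space UNIV d using assms by (simp add: polish_metric_def)
  have "MCauchy \<sigma>" using assms(2) unfolding MCauchy_def by simp
  then obtain x where "limitin mtopology \<sigma> x sequentially"
    using assms(1) by (auto simp: polish_metric_def mcomplete_def)
  moreover have "mtopology = euclidean" using assms by (simp add: polish_metric_def)
  ultimately show thesis using that by simp
qed

text \<open>For 0 < t < 1 both weights are positive, so the interpolated distance dominates a
  positive multiple of each coordinate distance and is itself at most their sum. Hence it separates
  points, induces the product topology, and has Cauchy sequences that are Cauchy in each
  coordinate.\<close>

lemma polish_metric_interp_dist:
  assumes X: "polish_metric dX" and Y: "polish_metric dY" and t: "0 < t" "t < 1"
  shows "polish_metric (interp_dist dX dY t)"
proof -
  let ?D = "interp_dist dX dY t"
  note X' = polish_metric_imp_cont_pseudo_metric[OF X]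
  note Y' = polish_metric_imp_cont_pseudo_metric[OF Y]
  have D: "cont_pseudo_metric ?D"
    using X' Y' t by (intro cont_pseudo_metric_interp_dist) auto
  interpret MX: Metric_space UNIV dX using X by (simp add: polish_metric_def)
  interpret MY: Metric_space UNIV dY using Y by (simp add: polish_metric_def)
  have geX: "(1 - t) * dX (fst u) (fst v) \<le> ?D u v" and geY: "t * dY (snd u) (snd v) \<le> ?D u v"
    for u v using t by (auto simp: interp_dist_def case_prod_beta')
  have zero: "u = v" if "?D u v = 0" for u v
  proof -
    have "(1 - t) * dX (fst u) (fst v) \<le> 0" "t * dY (snd u) (snd v) \<le> 0"
      using geX[of u v] geY[of u v] that by simp_all
    then have "dX (fst u) (fst v) \<le> 0" "dY (snd u) (snd v) \<le> 0"
      using t by (simp_all add: mult_le_0_iff)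
    then show ?thesis
      using MX.nonneg[of "fst u" "fst v"] MY.nonneg[of "snd u" "snd v"]
        MX.zero[of "fst u" "fst v"] MY.zero[of "snd u" "snd v"]
      by (auto intro: prod_eqI)
  qed
  interpret MD: Metric_space UNIV ?D
    using cont_pseudo_metricD(1-4)[OF D] zero by unfold_locales blast+
  have "openin MD.mtopology U \<longleftrightarrow> open U" for U
  proof
    assume U: "openin MD.mtopology U"
    show "open U"
      unfolding open_prod_def
    proof
      fix u assume "u \<in> U"
      then obtain r where r: "r > 0" "MD.mball u r \<subseteq> U"
        using U unfolding MD.openin_mtopology by blast
      \<comment> \<open>Since both weights are at most 1, two coordinate distances below r / 2 give
        an interpolated distance below r.\<close>
      let ?A = "{x. dX (fst u) x < r / 2}" and ?B = "{y. dY (snd u) y < r / 2}"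
      have "open ?A" "open ?B"
        using MX.openin_mball[of "fst u" "r / 2"] MY.openin_mball[of "snd u" "r / 2"] X Y
        by (auto simp: polish_metric_def MX.mball_def MY.mball_def)
      moreover have "u \<in> ?A \<times> ?B"
        using r by (cases u) auto
      moreover have "?A \<times> ?B \<subseteq> U"
      proof
        fix v assume v: "v \<in> ?A \<times> ?B"
        have "(1 - t) * dX (fst u) (fst v) \<le> 1 * dX (fst u) (fst v)"
          "t * dY (snd u) (snd v) \<le> 1 * dY (snd u) (snd v)"
          using t by (intro mult_right_mono; simp)+
        then have "?D u v < r"
          using v by (auto simp: interp_dist_def case_prod_beta')
        then show "v \<in> U" using r by auto
      qed
      ultimately show "\<exists>A B. open A \<and> open B \<and> u \<in> A \<times> B \<and> A \<times> B \<subseteq> U" by blast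
    qed
  next
    assume U: "open U"
    have "\<exists>r>0. MD.mball u r \<subseteq> U" if u: "u \<in> U" for u
    proof -
      obtain A B where AB: "open A" "open B" "u \<in> A \<times> B" "A \<times> B \<subseteq> U"
        using U u unfolding open_prod_def by meson
      obtain r1 where r1: "r1 > 0" "\<And>x. dX (fst u) x < r1 \<Longrightarrow> x \<in> A"
        using AB polish_metric_openin[OF X, of A] by auto
      obtain r2 where r2: "r2 > 0" "\<And>y. dY (snd u) y < r2 \<Longrightarrow> y \<in> B"
        using AB polish_metric_openin[OF Y, of B] by auto
      \<comment> \<open>The weights are built into the radius so that \<open>geX\<close> and
        \<open>geY\<close> can be divided by them, leaving coordinate distances below
        \<open>r1\<close> and \<open>r2\<close>.\<close>
      let ?r = "min ((1 - t) * r1) (t * r2)"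
      have "v \<in> U" if "?D u v < ?r" for v
      proof -
        have "(1 - t) * dX (fst u) (fst v) < (1 - t) * r1" "t * dY (snd u) (snd v) < t * r2"
          using geX[of u v] geY[of u v] that by linarith+
        then show ?thesis
          using r1(2)[of "fst v"] r2(2)[of "snd v"] AB t by (cases v) auto
      qed
      moreover have "?r > 0" using r1 r2 t by simp
      ultimately show ?thesis by (intro exI[of _ ?r]) auto
    qed
    then show "openin MD.mtopology U" by (auto simp: MD.openin_mtopology)
  qed
  then have top: "MD.mtopology = euclidean" by (simp add: topology_eq)
  have "MD.mcomplete"
    unfolding MD.mcomplete_def
  proof (intro allI impI)
    fix \<sigma> assume \<sigma>: "MD.MCauchy \<sigma>"
    have C: "\<exists>N. \<forall>n\<ge>N. \<forall>n'\<ge>N. ?D (\<sigma> n) (\<sigma> n') < e" if "e > 0" for e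
      using \<sigma> that unfolding MD.MCauchy_def by meson
    have "\<exists>N. \<forall>n\<ge>N. \<forall>n'\<ge>N. dX (fst (\<sigma> n)) (fst (\<sigma> n')) < e" if "e > 0" for e
    proof -
      \<comment> \<open>The tolerance is shrunk by the weight of the coordinate, which
        \<open>geX\<close> then cancels.\<close>
      obtain N where N: "?D (\<sigma> n) (\<sigma> n') < (1 - t) * e" if "n \<ge> N" "n' \<ge> N" for n n'
        using C[of "(1 - t) * e"] t \<open>e > 0\<close> by auto
      have "dX (fst (\<sigma> n)) (fst (\<sigma> n')) < e" if "n \<ge> N" "n' \<ge> N" for n n'
        using le_less_trans[OF geX N[OF that]] t by simp
      then show ?thesis by blast
    qed
    then obtain x where x: "(\<lambda>n. fst (\<sigma> n)) \<longlonglongrightarrow> x"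
      by (rule polish_metric_Cauchy_limit[OF X])
    have "\<exists>N. \<forall>n\<ge>N. \<forall>n'\<ge>N. dY (snd (\<sigma> n)) (snd (\<sigma> n')) < e" if "e > 0" for e
    proof -
      obtain N where N: "?D (\<sigma> n) (\<sigma> n') < t * e" if "n \<ge> N" "n' \<ge> N" for n n'
        using C[of "t * e"] t \<open>e > 0\<close> by auto
      have "dY (snd (\<sigma> n)) (snd (\<sigma> n')) < e" if "n \<ge> N" "n' \<ge> N" for n n'
        using le_less_trans[OF geY N[OF that]] t by simp
      then show ?thesis by blast
    qed
    then obtain y where y: "(\<lambda>n. snd (\<sigma> n)) \<longlonglongrightarrow> y"
      by (rule polish_metric_Cauchy_limit[OF Y])
    from tendsto_Pair[OF x y] have "\<sigma> \<longlonglongrightarrow> (x, y)" by simp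
    then show "\<exists>z. limitin MD.mtopology \<sigma> z sequentially" by (auto simp: top)
  qed
  then show ?thesis
    using top MD.Metric_space_axioms by (simp add: polish_metric_def)
qed

section \<open>Power inequalities and the l_m distance\<close>

lemma convex_combination_le_max:
  fixes u v t :: real
  assumes "t \<in> {0..1}"
  shows "(1 - t) * u + t * v \<le> max u v"
proof -
  have "(1 - t) * u + t * v \<le> (1 - t) * max u v + t * max u v"
    using assms by (intro add_mono mult_left_mono) auto
  then show ?thesis by (simp add: algebra_simps)
qed

text \<open>Passing through the maximum works for every exponent q \<ge> 0, whereas convexity of the
  power would require q \<ge> 1. It serves with q = m for feature coordinates and q = p for
  structure distances.\<close>

lemma convex_combination_powr_le:
  fixes u v t q :: real
  assumes "t \<in> {0..1}" "0 \<le> u" "0 \<le> v" "0 \<le> q"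
  shows "((1 - t) * u + t * v) powr q \<le> u powr q + v powr q"
proof -
  have "((1 - t) * u + t * v) powr q \<le> max u v powr q"
    using assms convex_combination_le_max[OF assms(1)] by (intro powr_mono2) auto
  also have "\<dots> \<le> u powr q + v powr q"
    by (auto simp: max_def)
  finally show ?thesis .
qed

text \<open>A sum is twice a midpoint. The exponent will be p / m, which may lie on either side of
  1.\<close>

lemma powr_add_le:
  fixes u v q :: real
  assumes "0 \<le> u" "0 \<le> v" "0 \<le> q"
  shows "(u + v) powr q \<le> 2 powr q * (u powr q + v powr q)"
proof -
  have "u + v = 2 * ((1 - 1 / 2) * u + (1 / 2) * v)"
    by simp
  then have "(u + v) powr q = 2 powr q * ((1 - 1 / 2) * u + (1 / 2) * v) powr q"
    using assms by (metis powr_mult)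
  also have "\<dots> \<le> 2 powr q * (u powr q + v powr q)"
    using assms by (intro mult_left_mono convex_combination_powr_le) auto
  finally show ?thesis .
qed

lemma lm_dist_nonneg: "0 \<le> lm_dist m a b"
  by (simp add: lm_dist_def)

lemma lm_dist_self: "lm_dist m a a = 0"
  by (simp add: lm_dist_def)

text \<open>Homogeneity of the norm, phrased through coordinate differences so that it applies to
  two interpolants of the same pair of points.\<close>

lemma lm_dist_scale:
  assumes "m > 0" and "\<And>i. a $ i - b $ i = c * (a' $ i - b' $ i)"
  shows "lm_dist m a b = \<bar>c\<bar> * lm_dist m a' b'"
proof -
  have "(\<Sum>i\<in>UNIV. \<bar>a $ i - b $ i\<bar> powr m) = \<bar>c\<bar> powr m * (\<Sum>i\<in>UNIV. \<bar>a' $ i - b' $ i\<bar> powr m)"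
    by (simp add: assms(2) abs_mult powr_mult sum_distrib_left)
  then show ?thesis
    using assms(1) by (simp add: lm_dist_def powr_mult sum_nonneg powr_powr)
qed

text \<open>
  The constant \<open>2 powr (p / m)\<close> is not sharp: it only serves finiteness of moments, and allowing it
  avoids Minkowski's inequality.
\<close>
lemma lm_dist_interp_powr_le:
  fixes a b a0 b0 :: "real ^ 'n"
  assumes "m > 0" "p \<ge> 0" "t \<in> {0..1}"
  shows "lm_dist m ((1 - t) *\<^sub>R a + t *\<^sub>R b) ((1 - t) *\<^sub>R a0 + t *\<^sub>R b0) powr p
    \<le> 2 powr (p / m) * (lm_dist m a a0 powr p + lm_dist m b b0 powr p)"
proof -
  define S where "S a b = (\<Sum>i\<in>UNIV. \<bar>a $ i - b $ i\<bar> powr m)" for a b :: "real ^ 'n"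
  have S_nonneg: "0 \<le> S a b" for a b by (simp add: S_def sum_nonneg)
  \<comment> \<open>Merging the exponents 1 / m and p lets the estimate run coordinatewise on
    \<open>S\<close>, with a single power p / m taken at the end.\<close>
  have lm_S: "lm_dist m a b powr p = S a b powr (p / m)" for a b :: "real ^ 'n"
    by (simp add: lm_dist_def S_def powr_powr)
  have "\<bar>((1 - t) *\<^sub>R a + t *\<^sub>R b) $ i - ((1 - t) *\<^sub>R a0 + t *\<^sub>R b0) $ i\<bar> powr m
      \<le> \<bar>a $ i - a0 $ i\<bar> powr m + \<bar>b $ i - b0 $ i\<bar> powr m" for i
  proof -
    have "((1 - t) *\<^sub>R a + t *\<^sub>R b) $ i - ((1 - t) *\<^sub>R a0 + t *\<^sub>R b0) $ i =
        (1 - t) * (a $ i - a0 $ i) + t * (b $ i - b0 $ i)"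
      by (simp add: algebra_simps)
    also have "\<bar>\<dots>\<bar> \<le> (1 - t) * \<bar>a $ i - a0 $ i\<bar> + t * \<bar>b $ i - b0 $ i\<bar>"
      using assms by (intro order_trans[OF abs_triangle_ineq]) (simp add: abs_mult)
    finally have "\<bar>((1 - t) *\<^sub>R a + t *\<^sub>R b) $ i - ((1 - t) *\<^sub>R a0 + t *\<^sub>R b0) $ i\<bar> powr m
      \<le> ((1 - t) * \<bar>a $ i - a0 $ i\<bar> + t * \<bar>b $ i - b0 $ i\<bar>) powr m"
      using assms by (intro powr_mono2) auto
    also have "\<dots> \<le> \<bar>a $ i - a0 $ i\<bar> powr m + \<bar>b $ i - b0 $ i\<bar> powr m"
      using assms by (intro convex_combination_powr_le) auto
    finally show ?thesis .
  qed
  then have "S ((1 - t) *\<^sub>R a + t *\<^sub>R b) ((1 - t) *\<^sub>R a0 + t *\<^sub>R b0) \<le> S a a0 + S b b0"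
    unfolding S_def sum.distrib[symmetric] by (intro sum_mono)
  then have "S ((1 - t) *\<^sub>R a + t *\<^sub>R b) ((1 - t) *\<^sub>R a0 + t *\<^sub>R b0) powr (p / m)
      \<le> (S a a0 + S b b0) powr (p / m)"
    using assms S_nonneg by (intro powr_mono2) auto
  also have "\<dots> \<le> 2 powr (p / m) * (S a a0 powr (p / m) + S b b0 powr (p / m))"
    using assms S_nonneg by (intro powr_add_le) auto
  finally show ?thesis unfolding lm_S .
qed

lemma borel_measurable_lm_dist [measurable (raw)]:
  assumes "f \<in> M \<rightarrow>\<^sub>M borel" "g \<in> M \<rightarrow>\<^sub>M borel"
  shows "(\<lambda>z. lm_dist m (f z) (g z)) \<in> borel_measurable M"
proof -
  note [measurable] = assms[THEN measurable_compose[OF _ borel_measurable_nth]]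
  show ?thesis unfolding lm_dist_def by measurable
qed

section \<open>Push-forwards, couplings and their cost\<close>

lemma borel_measurable_interp_map:
  "(interp_map t :: ('x::topological_space \<times> 'w::real_normed_vector) \<times> ('y::topological_space \<times> 'w)
      \<Rightarrow> _) \<in> borel \<rightarrow>\<^sub>M borel"
  unfolding interp_map_def case_prod_beta'
  by (intro borel_measurable_continuous_onI continuous_intros)

text \<open>Change of variables in each integral in turn; sigma-finiteness of \<open>M\<close> makes
  the inner integral measurable in the outer variable.\<close>

lemma nn_integral_distr2:
  assumes M: "sigma_finite_measure M" and g [measurable]: "g \<in> M \<rightarrow>\<^sub>M N"
    and f [measurable]: "case_prod f \<in> borel_measurable (N \<Otimes>\<^sub>M N)"
  shows "(\<integral>\<^sup>+ u. (\<integral>\<^sup>+ v. f u v \<partial>distr M N g) \<partial>distr M N g) =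
    (\<integral>\<^sup>+ u. (\<integral>\<^sup>+ v. f (g u) (g v) \<partial>M) \<partial>M)"
proof -
  interpret sigma_finite_measure M by (fact M)
  have "(\<integral>\<^sup>+ u. (\<integral>\<^sup>+ v. f u v \<partial>distr M N g) \<partial>distr M N g) =
      (\<integral>\<^sup>+ u. (\<integral>\<^sup>+ v. f u (g v) \<partial>M) \<partial>distr M N g)"
    by (intro nn_integral_cong nn_integral_distr) simp_all
  also have "\<dots> = (\<integral>\<^sup>+ u. (\<integral>\<^sup>+ v. f (g u) (g v) \<partial>M) \<partial>M)"
    by (intro nn_integral_distr) simp_all
  finally show ?thesis .
qed

lemma borel_prob_measurable:
  fixes g :: "'z::topological_space \<Rightarrow> 'u::topological_space"
  assumes "borel_prob \<pi>" "g \<in> borel \<rightarrow>\<^sub>M borel"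
  shows "g \<in> \<pi> \<rightarrow>\<^sub>M borel"
  using assms measurable_cong_sets[of \<pi> borel "borel :: 'u measure" borel] by (simp add: borel_prob_def)

lemma borel_prob_distr:
  assumes "borel_prob \<pi>" "g \<in> borel \<rightarrow>\<^sub>M borel"
  shows "borel_prob (distr \<pi> borel g)"
  using assms borel_prob_measurable[OF assms]
  by (auto simp: borel_prob_def intro!: prob_space.prob_space_distr)

lemma fgw_cost_eq:
  "fgw_cost d \<alpha> p dX dY \<pi> = (\<integral>\<^sup>+ z. (\<integral>\<^sup>+ z'. ennreal (((1 - \<alpha>) * d (snd (fst z)) (snd (snd z)) +
      \<alpha> * \<bar>dX (fst (fst z)) (fst (fst z')) - dY (fst (snd z)) (fst (snd z'))\<bar>) powr p) \<partial>\<pi>) \<partial>\<pi>)"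
  by (simp add: fgw_cost_def case_prod_beta')

lemma borel_measurable_fgw_integrand:
  fixes dU :: "'u::second_countable_topology \<Rightarrow> 'u \<Rightarrow> real"
    and dV :: "'v::second_countable_topology \<Rightarrow> 'v \<Rightarrow> real"
  assumes U: "cont_pseudo_metric dU" and V: "cont_pseudo_metric dV"
  shows "(\<lambda>(z :: ('u \<times> (real ^ 'n)) \<times> ('v \<times> (real ^ 'n)), z').
      ennreal (((1 - \<alpha>) * lm_dist m (snd (fst z)) (snd (snd z)) +
      \<alpha> * \<bar>dU (fst (fst z)) (fst (fst z')) - dV (fst (snd z)) (fst (snd z'))\<bar>) powr p))
    \<in> borel_measurable (borel \<Otimes>\<^sub>M borel)"
proof -
  note [measurable] = borel_measurable_cont_pseudo_metric[OF U] borel_measurable_cont_pseudo_metric[OF V]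
  show ?thesis by measurable
qed

text \<open>The competing couplings constructed below are push-forwards of \<pi>. This turns their
  costs into double integrals against \<pi> itself, where integrands can be compared
  pointwise.\<close>

lemma fgw_cost_distr:
  fixes dU :: "'u::second_countable_topology \<Rightarrow> 'u \<Rightarrow> real"
    and dV :: "'v::second_countable_topology \<Rightarrow> 'v \<Rightarrow> real"
    and g :: "'z::topological_space \<Rightarrow> ('u \<times> (real ^ 'n)) \<times> ('v \<times> (real ^ 'n))"
  assumes \<pi>: "borel_prob \<pi>" and g: "g \<in> borel \<rightarrow>\<^sub>M borel"
    and U: "cont_pseudo_metric dU" and V: "cont_pseudo_metric dV"
  shows "fgw_cost (lm_dist m) \<alpha> p dU dV (distr \<pi> borel g) =
    (\<integral>\<^sup>+ z. (\<integral>\<^sup>+ z'. ennreal (((1 - \<alpha>) * lm_dist m (snd (fst (g z))) (snd (snd (g z))) +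
      \<alpha> * \<bar>dU (fst (fst (g z))) (fst (fst (g z'))) - dV (fst (snd (g z))) (fst (snd (g z')))\<bar>) powr p)
      \<partial>\<pi>) \<partial>\<pi>)"
  unfolding fgw_cost_eq
proof (rule nn_integral_distr2)
  show "sigma_finite_measure \<pi>"
    using \<pi> by (auto simp: borel_prob_def intro: prob_space_imp_sigma_finite)
  show "g \<in> \<pi> \<rightarrow>\<^sub>M borel"
    using \<pi> g by (rule borel_prob_measurable)
qed (rule borel_measurable_fgw_integrand[OF U V])

lemma distr_in_couplings:
  assumes \<pi>: "borel_prob \<pi>" and g: "g \<in> borel \<rightarrow>\<^sub>M borel"
    and "distr \<pi> borel (fst \<circ> g) = \<mu>" "distr \<pi> borel (snd \<circ> g) = \<nu>"
  shows "distr \<pi> borel g \<in> couplings \<mu> \<nu>"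
proof -
  have "g \<in> \<pi> \<rightarrow>\<^sub>M borel"
    using \<pi> g by (rule borel_prob_measurable)
  then show ?thesis
    using assms borel_prob_distr[OF \<pi> g]
    by (simp add: couplings_def distr_distr borel_measurable_fst borel_measurable_snd)
qed

section \<open>The p-th root, and distances along the curve and at its endpoints\<close>

lemma ennreal_root_mono:
  assumes "p > 0" "u \<le> v"
  shows "ennreal_root p u \<le> ennreal_root p v"
proof (cases "v = \<infinity>")
  case False
  then have "u \<noteq> \<infinity>" and "enn2real u \<le> enn2real v"
    using assms by (auto simp: top_unique less_top intro: enn2real_mono)
  then show ?thesis
    using False assms by (auto simp: ennreal_root_def intro!: ennreal_leI powr_mono2)
qed (simp add: ennreal_root_def)

text \<open>The degenerate cases rest on 0 * \<infinity> = 0: for c = 0 both sides vanish, and for c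
  > 0 with v = \<infinity> both are infinite.\<close>

lemma ennreal_root_powr_mult:
  assumes "p > 0" "c \<ge> 0"
  shows "ennreal_root p (ennreal (c powr p) * v) = ennreal c * ennreal_root p v"
proof (cases "c = 0 \<or> v = \<infinity>")
  case True
  then show ?thesis
    using assms by (auto simp: ennreal_root_def ennreal_mult_top)
next
  case False
  then obtain r where r: "0 \<le> r" "v = ennreal r"
    by (cases v) auto
  then have "ennreal (c powr p) * v = ennreal (c powr p * r)"
    by (simp add: ennreal_mult)
  then show ?thesis
    using assms r by (simp add: ennreal_root_def powr_mult powr_powr flip: ennreal_mult)
qed

lemma FGW_le_ennreal_root_cost:
  assumes "p > 0" "\<pi> \<in> couplings \<mu> \<nu>"
  shows "FGW d \<alpha> p (dX, \<mu>) (dY, \<nu>) \<le> ennreal_root p (fgw_cost d \<alpha> p dX dY \<pi>)"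
  unfolding FGW_def prod.case by (intro ennreal_root_mono INF_lower assms)

text \<open>Optimality makes the infimum a minimum, attained at \<pi>.\<close>

lemma FGW_optimal_coupling:
  assumes "optimal_coupling d \<alpha> p (dX, \<mu>) (dY, \<nu>) \<pi>"
  shows "FGW d \<alpha> p (dX, \<mu>) (dY, \<nu>) = ennreal_root p (fgw_cost d \<alpha> p dX dY \<pi>)"
proof -
  have "(INF \<pi>'\<in>couplings \<mu> \<nu>. fgw_cost d \<alpha> p dX dY \<pi>') = fgw_cost d \<alpha> p dX dY \<pi>"
    using assms by (intro antisym INF_lower INF_greatest) (auto simp: optimal_coupling_def)
  then show ?thesis by (simp add: FGW_def)
qed

text \<open>The right-hand side is the cost of an arbitrary Borel probability \<pi>; optimality
  enters only later, when this cost is identified with the distance of the endpoints.\<close>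

lemma FGW_interp_obj_le:
  fixes dX :: "'x::second_countable_topology \<Rightarrow> 'x \<Rightarrow> real"
    and dY :: "'y::second_countable_topology \<Rightarrow> 'y \<Rightarrow> real"
    and \<pi> :: "(('x \<times> (real ^ 'n)) \<times> ('y \<times> (real ^ 'n))) measure"
  assumes m: "m > 0" and p: "p > 0" and \<alpha>: "0 \<le> \<alpha>" "\<alpha> \<le> 1"
    and X: "cont_pseudo_metric dX" and Y: "cont_pseudo_metric dY" and \<pi>: "borel_prob \<pi>"
    and ts: "t \<in> {0..1}" "s \<in> {0..1}"
  shows "FGW (lm_dist m) \<alpha> p (interp_obj dX dY \<pi> t) (interp_obj dX dY \<pi> s)
    \<le> ennreal \<bar>t - s\<bar> * ennreal_root p (fgw_cost (lm_dist m) \<alpha> p dX dY \<pi>)"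
proof -
  let ?g = "\<lambda>z :: ('x \<times> (real ^ 'n)) \<times> ('y \<times> (real ^ 'n)). (interp_map t z, interp_map s z)"
  let ?D = "\<lambda>t. interp_dist dX dY t"
  define c where "c z z' = ((1 - \<alpha>) * lm_dist m (snd (fst z)) (snd (snd z)) +
      \<alpha> * \<bar>dX (fst (fst z)) (fst (fst z')) - dY (fst (snd z)) (fst (snd z'))\<bar>) powr p"
    for z z' :: "('x \<times> (real ^ 'n)) \<times> ('y \<times> (real ^ 'n))"
  have [measurable]: "(\<lambda>(z, z'). ennreal (c z z')) \<in> borel_measurable (borel \<Otimes>\<^sub>M borel)"
    unfolding c_def by (rule borel_measurable_fgw_integrand[OF X Y])
  have [measurable_cong]: "sets \<pi> = sets borel" using \<pi> by (simp add: borel_prob_def)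
  interpret prob_space \<pi> using \<pi> by (simp add: borel_prob_def)
  have g: "?g \<in> borel \<rightarrow>\<^sub>M borel"
    by (intro borel_measurable_Pair borel_measurable_interp_map)
  have D: "cont_pseudo_metric (?D r)" if "r \<in> {0..1}" for r
    using cont_pseudo_metric_interp_dist[OF X Y that] .
  have cost: "((1 - \<alpha>) * lm_dist m (snd (fst (?g z))) (snd (snd (?g z))) +
      \<alpha> * \<bar>?D t (fst (fst (?g z))) (fst (fst (?g z'))) - ?D s (fst (snd (?g z))) (fst (snd (?g z')))\<bar>) powr p
    = \<bar>t - s\<bar> powr p * c z z'" for z z'
  proof -
    \<comment> \<open>The interpolants at times t and s differ by (s - t)(a - b), hence the swap
      inside the absolute value. The structure distances below differ by the same factor s -
      t.\<close>
    have a: "lm_dist m (snd (fst (?g z))) (snd (snd (?g z))) =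
        \<bar>t - s\<bar> * lm_dist m (snd (fst z)) (snd (snd z))"
      unfolding abs_minus_commute[of t s]
      using m by (intro lm_dist_scale) (auto simp: interp_map_def case_prod_beta' algebra_simps)
    have "?D t (fst (fst (?g z))) (fst (fst (?g z'))) - ?D s (fst (snd (?g z))) (fst (snd (?g z')))
      = (s - t) * (dX (fst (fst z)) (fst (fst z')) - dY (fst (snd z)) (fst (snd z')))"
      by (simp add: interp_dist_def interp_map_def case_prod_beta' algebra_simps)
    then have b: "\<bar>?D t (fst (fst (?g z))) (fst (fst (?g z'))) - ?D s (fst (snd (?g z))) (fst (snd (?g z')))\<bar>
      = \<bar>t - s\<bar> * \<bar>dX (fst (fst z)) (fst (fst z')) - dY (fst (snd z)) (fst (snd z'))\<bar>"
      by (simp add: abs_mult abs_minus_commute)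
    have "(1 - \<alpha>) * (\<bar>t - s\<bar> * A) + \<alpha> * (\<bar>t - s\<bar> * B) = \<bar>t - s\<bar> * ((1 - \<alpha>) * A + \<alpha> * B)" for A B :: real
      by (simp add: algebra_simps)
    then show ?thesis
      unfolding a b c_def using \<alpha> by (simp add: powr_mult lm_dist_nonneg)
  qed
  have "fgw_cost (lm_dist m) \<alpha> p (?D t) (?D s) (distr \<pi> borel ?g) =
      (\<integral>\<^sup>+ z. (\<integral>\<^sup>+ z'. ennreal (\<bar>t - s\<bar> powr p) * ennreal (c z z') \<partial>\<pi>) \<partial>\<pi>)"
    unfolding fgw_cost_distr[OF \<pi> g D[OF ts(1)] D[OF ts(2)]] cost
    by (simp add: ennreal_mult c_def)
  also have "\<dots> = (\<integral>\<^sup>+ z. ennreal (\<bar>t - s\<bar> powr p) * (\<integral>\<^sup>+ z'. ennreal (c z z') \<partial>\<pi>) \<partial>\<pi>)"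
    by (intro nn_integral_cong nn_integral_cmult) measurable
  also have "\<dots> = ennreal (\<bar>t - s\<bar> powr p) * fgw_cost (lm_dist m) \<alpha> p dX dY \<pi>"
    unfolding fgw_cost_eq c_def[symmetric] by (intro nn_integral_cmult) measurable
  finally have "ennreal_root p (fgw_cost (lm_dist m) \<alpha> p (?D t) (?D s) (distr \<pi> borel ?g)) =
      ennreal \<bar>t - s\<bar> * ennreal_root p (fgw_cost (lm_dist m) \<alpha> p dX dY \<pi>)"
    using p by (simp add: ennreal_root_powr_mult)
  moreover have coupling: "distr \<pi> borel ?g \<in>
      couplings (distr \<pi> borel (interp_map t)) (distr \<pi> borel (interp_map s))"
    using \<pi> g by (intro distr_in_couplings) (auto simp: comp_def)
  ultimately show ?thesis
    using FGW_le_ennreal_root_cost[OF p coupling, of "lm_dist m" \<alpha> "?D t" "?D s"] unfolding interp_obj_def by simp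
qed

text \<open>The coupling by \<open>(f z, h z)\<close> matches points with equal features and equal
  mutual structure distances, so its integrand vanishes identically. At the endpoints,
  \<open>f\<close> is \<open>interp_map 0\<close> or \<open>interp_map 1\<close> and
  \<open>h\<close> is the matching projection.\<close>

lemma FGW_distr_eq_0:
  fixes dX :: "'x::second_countable_topology \<Rightarrow> 'x \<Rightarrow> real"
    and dU :: "'u::second_countable_topology \<Rightarrow> 'u \<Rightarrow> real"
    and f :: "'z::topological_space \<Rightarrow> 'u \<times> (real ^ 'n)" and h :: "'z \<Rightarrow> 'x \<times> (real ^ 'n)"
  assumes p: "p > 0" and U: "cont_pseudo_metric dU" and X: "cont_pseudo_metric dX"
    and \<pi>: "borel_prob \<pi>" and f: "f \<in> borel \<rightarrow>\<^sub>M borel" and h: "h \<in> borel \<rightarrow>\<^sub>M borel"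
    and feature: "\<And>z. snd (f z) = snd (h z)"
    and isometry: "\<And>z z'. dU (fst (f z)) (fst (f z')) = dX (fst (h z)) (fst (h z'))"
  shows "FGW (lm_dist m) \<alpha> p (dU, distr \<pi> borel f) (dX, distr \<pi> borel h) = 0"
proof -
  have g: "(\<lambda>z. (f z, h z)) \<in> borel \<rightarrow>\<^sub>M borel"
    by (intro borel_measurable_Pair f h)
  have "fgw_cost (lm_dist m) \<alpha> p dU dX (distr \<pi> borel (\<lambda>z. (f z, h z))) = 0"
    using p unfolding fgw_cost_distr[OF \<pi> g U X] by (simp add: feature isometry lm_dist_self)
  moreover have coupling: "distr \<pi> borel (\<lambda>z. (f z, h z)) \<in> couplings (distr \<pi> borel f) (distr \<pi> borel h)"
    using \<pi> g by (intro distr_in_couplings) (auto simp: comp_def)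
  ultimately have "FGW (lm_dist m) \<alpha> p (dU, distr \<pi> borel f) (dX, distr \<pi> borel h) \<le> ennreal_root p 0"
    using FGW_le_ennreal_root_cost[OF p coupling, of "lm_dist m" \<alpha> dU dX] by simp
  then show ?thesis using p by (simp add: ennreal_root_def)
qed

section \<open>Finite moments of the interpolated objects\<close>

lemma nn_integral_powr_sum_finite:
  assumes [measurable]: "f \<in> borel_measurable M" "g \<in> borel_measurable M"
    and le: "\<And>z. h z \<le> C * (f z + g z)" and nonneg: "\<And>z. 0 \<le> f z" "\<And>z. 0 \<le> g z" "0 \<le> C"
    and fin: "(\<integral>\<^sup>+ z. ennreal (f z) \<partial>M) < \<infinity>" "(\<integral>\<^sup>+ z. ennreal (g z) \<partial>M) < \<infinity>"
  shows "(\<integral>\<^sup>+ z. ennreal (h z) \<partial>M) < \<infinity>"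
proof -
  have "(\<integral>\<^sup>+ z. ennreal (h z) \<partial>M) \<le> (\<integral>\<^sup>+ z. ennreal C * (ennreal (f z) + ennreal (g z)) \<partial>M)"
    using nonneg le by (intro nn_integral_mono) (simp flip: ennreal_plus ennreal_mult add: ennreal_leI)
  also have "\<dots> = ennreal C * ((\<integral>\<^sup>+ z. ennreal (f z) \<partial>M) + (\<integral>\<^sup>+ z. ennreal (g z) \<partial>M))"
    by (simp add: nn_integral_cmult nn_integral_add)
  also have "\<dots> < \<infinity>"
    using fin by (simp add: ennreal_mult_less_top)
  finally show ?thesis .
qed

text \<open>All marginals involved are push-forwards of \<pi>, so the moments at time t become
  integrals over \<pi> or its square, dominated by the corresponding moments of the two
  endpoints.\<close>

lemma finite_moments_interp_obj:
  fixes dX :: "'x::second_countable_topology \<Rightarrow> 'x \<Rightarrow> real"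
    and dY :: "'y::second_countable_topology \<Rightarrow> 'y \<Rightarrow> real"
    and \<pi> :: "(('x \<times> (real ^ 'n)) \<times> ('y \<times> (real ^ 'n))) measure"
  assumes m: "m > 0" and p: "p \<ge> 0" and t: "t \<in> {0..1}"
    and X: "cont_pseudo_metric dX" and Y: "cont_pseudo_metric dY" and \<pi>: "\<pi> \<in> couplings \<mu>0 \<mu>1"
    and fin0: "finite_moments (lm_dist m) p (dX, \<mu>0)" and fin1: "finite_moments (lm_dist m) p (dY, \<mu>1)"
  shows "finite_moments (lm_dist m) p (interp_obj dX dY \<pi> t)"
proof -
  note [measurable] = borel_measurable_cont_pseudo_metric[OF X] borel_measurable_cont_pseudo_metric[OF Y]
    borel_measurable_fst borel_measurable_snd
    borel_measurable_cont_pseudo_metric[OF cont_pseudo_metric_interp_dist[OF X Y t]]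
  have bp: "borel_prob \<pi>" and \<mu>: "\<mu>0 = distr \<pi> borel fst" "\<mu>1 = distr \<pi> borel snd"
    using \<pi> by (auto simp: couplings_def)
  have [measurable_cong]: "sets \<pi> = sets borel" using bp by (simp add: borel_prob_def)
  interpret prob_space \<pi> using bp by (simp add: borel_prob_def)
  have [measurable]: "interp_map t \<in> \<pi> \<rightarrow>\<^sub>M borel"
    using bp borel_measurable_interp_map by (rule borel_prob_measurable)
  have sm0: "struct_marginal \<mu>0 = distr \<pi> borel (\<lambda>z. fst (fst z))"
    and fm0: "feature_marginal \<mu>0 = distr \<pi> borel (\<lambda>z. snd (fst z))"
    and sm1: "struct_marginal \<mu>1 = distr \<pi> borel (\<lambda>z. fst (snd z))"
    and fm1: "feature_marginal \<mu>1 = distr \<pi> borel (\<lambda>z. snd (snd z))"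
    unfolding struct_marginal_def feature_marginal_def \<mu> by (simp_all add: distr_distr comp_def)
  have smt: "struct_marginal (distr \<pi> borel (interp_map t)) = distr \<pi> borel (\<lambda>z. fst (interp_map t z))"
    and fmt: "feature_marginal (distr \<pi> borel (interp_map t)) = distr \<pi> borel (\<lambda>z. snd (interp_map t z))"
    unfolding struct_marginal_def feature_marginal_def by (simp_all add: distr_distr comp_def)
  \<comment> \<open>Iterated integrals are merged by Tonelli so that the domination lemma, stated
    for one integral, also covers the structure moments.\<close>
  have struct: "(\<integral>\<^sup>+ u. (\<integral>\<^sup>+ v. ennreal (d u v powr p) \<partial>distr \<pi> borel f) \<partial>distr \<pi> borel f) =
      (\<integral>\<^sup>+ (z, z'). ennreal (d (f z) (f z') powr p) \<partial>(\<pi> \<Otimes>\<^sub>M \<pi>))"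
    if d: "cont_pseudo_metric d" and [measurable]: "f \<in> \<pi> \<rightarrow>\<^sub>M borel"
    for d :: "'s::second_countable_topology \<Rightarrow> 's \<Rightarrow> real" and f
  proof -
    note [measurable] = borel_measurable_cont_pseudo_metric[OF d]
    have "(\<integral>\<^sup>+ u. (\<integral>\<^sup>+ v. ennreal (d u v powr p) \<partial>distr \<pi> borel f) \<partial>distr \<pi> borel f) =
      (\<integral>\<^sup>+ z. (\<integral>\<^sup>+ z'. ennreal (d (f z) (f z') powr p) \<partial>\<pi>) \<partial>\<pi>)"
      by (rule nn_integral_distr2) (unfold_locales, measurable)
    also have "\<dots> = (\<integral>\<^sup>+ (z, z'). ennreal (d (f z) (f z') powr p) \<partial>(\<pi> \<Otimes>\<^sub>M \<pi>))"
      using nn_integral_fst[of "\<lambda>(z, z'). ennreal (d (f z) (f z') powr p)" \<pi>] by simp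
    finally show ?thesis .
  qed
  obtain a0 where a0: "(\<integral>\<^sup>+ a. ennreal (lm_dist m a a0 powr p) \<partial>feature_marginal \<mu>0) < \<infinity>"
    using fin0 by (auto simp: finite_moments_def)
  obtain b0 where b0: "(\<integral>\<^sup>+ b. ennreal (lm_dist m b b0 powr p) \<partial>feature_marginal \<mu>1) < \<infinity>"
    using fin1 by (auto simp: finite_moments_def)
  \<comment> \<open>The base point at time t is the interpolant of the base points of the
    endpoints.\<close>
  have "(\<integral>\<^sup>+ z. ennreal (lm_dist m (snd (interp_map t z)) ((1 - t) *\<^sub>R a0 + t *\<^sub>R b0) powr p) \<partial>\<pi>) < \<infinity>"
  proof (rule nn_integral_powr_sum_finite)
    show "lm_dist m (snd (interp_map t z)) ((1 - t) *\<^sub>R a0 + t *\<^sub>R b0) powr p \<le>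
        2 powr (p / m) * (lm_dist m (snd (fst z)) a0 powr p + lm_dist m (snd (snd z)) b0 powr p)"
      for z :: "('x \<times> (real ^ 'n)) \<times> ('y \<times> (real ^ 'n))"
      using lm_dist_interp_powr_le[OF m p t] by (simp add: interp_map_def case_prod_beta')
    show "(\<integral>\<^sup>+ z. ennreal (lm_dist m (snd (fst z)) a0 powr p) \<partial>\<pi>) < \<infinity>"
      using a0 unfolding fm0 by (subst (asm) nn_integral_distr) auto
    show "(\<integral>\<^sup>+ z. ennreal (lm_dist m (snd (snd z)) b0 powr p) \<partial>\<pi>) < \<infinity>"
      using b0 unfolding fm1 by (subst (asm) nn_integral_distr) auto
  qed simp_all
  then have feature: "(\<integral>\<^sup>+ a. ennreal (lm_dist m a ((1 - t) *\<^sub>R a0 + t *\<^sub>R b0) powr p)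
      \<partial>feature_marginal (distr \<pi> borel (interp_map t))) < \<infinity>"
    unfolding fmt by (subst nn_integral_distr) auto
  have "(\<integral>\<^sup>+ w. ennreal (interp_dist dX dY t (fst (interp_map t (fst w))) (fst (interp_map t (snd w))) powr p)
      \<partial>(\<pi> \<Otimes>\<^sub>M \<pi>)) < \<infinity>"
  proof (rule nn_integral_powr_sum_finite)
    show "interp_dist dX dY t (fst (interp_map t (fst w))) (fst (interp_map t (snd w))) powr p \<le>
        1 * (dX (fst (fst (fst w))) (fst (fst (snd w))) powr p +
        dY (fst (snd (fst w))) (fst (snd (snd w))) powr p)" for w
      using convex_combination_powr_le[OF t _ _ p] cont_pseudo_metricD(2)[OF X] cont_pseudo_metricD(2)[OF Y]
      by (simp add: interp_map_def interp_dist_def case_prod_beta')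
    show "(\<integral>\<^sup>+ w. ennreal (dX (fst (fst (fst w))) (fst (fst (snd w))) powr p) \<partial>(\<pi> \<Otimes>\<^sub>M \<pi>)) < \<infinity>"
      using fin0 by (simp add: finite_moments_def sm0 struct[OF X] case_prod_beta')
    show "(\<integral>\<^sup>+ w. ennreal (dY (fst (snd (fst w))) (fst (snd (snd w))) powr p) \<partial>(\<pi> \<Otimes>\<^sub>M \<pi>)) < \<infinity>"
      using fin1 by (simp add: finite_moments_def sm1 struct[OF Y] case_prod_beta')
  qed simp_all
  then show ?thesis
    using feature unfolding interp_obj_def finite_moments_def
    by (auto simp: smt struct[OF cont_pseudo_metric_interp_dist[OF X Y t]] case_prod_beta')
qed

theorem theorem3p5p3:
  fixes dX :: "'x::second_countable_topology \<Rightarrow> 'x \<Rightarrow> real"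
    and dY :: "'y::second_countable_topology \<Rightarrow> 'y \<Rightarrow> real"
    and \<mu>0 :: "('x \<times> (real ^ 'n)) measure"
    and \<mu>1 :: "('y \<times> (real ^ 'n)) measure"
    and \<pi> :: "(('x \<times> (real ^ 'n)) \<times> ('y \<times> (real ^ 'n))) measure"
    and m p \<alpha> :: real
  assumes "m \<ge> 1" and "p \<ge> 1" and "0 < \<alpha>" and "\<alpha> < 1"
    and "(dX, \<mu>0) \<in> struct_space (lm_dist m) p"
    and "(dY, \<mu>1) \<in> struct_space (lm_dist m) p"
    and "optimal_coupling (lm_dist m) \<alpha> p (dX, \<mu>0) (dY, \<mu>1) \<pi>"
  shows "(\<forall>t\<in>{0..1}. interp_obj dX dY \<pi> t \<in> pseudo_struct_space (lm_dist m) p) \<and>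
    (\<forall>t\<in>{0<..<1}. interp_obj dX dY \<pi> t \<in> struct_space (lm_dist m) p) \<and>
    FGW_constant_speed_geodesic (lm_dist m) \<alpha> p (interp_obj dX dY \<pi>) (dX, \<mu>0) (dY, \<mu>1)"
proof -
  have pX: "polish_metric dX" and pY: "polish_metric dY"
    and fin: "finite_moments (lm_dist m) p (dX, \<mu>0)" "finite_moments (lm_dist m) p (dY, \<mu>1)"
    using assms by (auto simp: struct_space_def)
  have X: "cont_pseudo_metric dX" and Y: "cont_pseudo_metric dY"
    using pX pY by (auto intro: polish_metric_imp_cont_pseudo_metric)
  have coupling: "\<pi> \<in> couplings \<mu>0 \<mu>1"
    using assms by (simp add: optimal_coupling_def)
  then have \<pi>: "borel_prob \<pi>" and \<mu>: "\<mu>0 = distr \<pi> borel fst" "\<mu>1 = distr \<pi> borel snd"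
    by (auto simp: couplings_def)
  have moments: "finite_moments (lm_dist m) p (interp_obj dX dY \<pi> t)" if "t \<in> {0..1}" for t
    using assms(1,2) that by (intro finite_moments_interp_obj[OF _ _ _ X Y coupling fin]) auto
  have prob: "borel_prob (distr \<pi> borel (interp_map t))" for t
    by (intro borel_prob_distr \<pi> borel_measurable_interp_map)
  have "interp_obj dX dY \<pi> t \<in> pseudo_struct_space (lm_dist m) p" if "t \<in> {0..1}" for t
    using moments[OF that] prob cont_pseudo_metric_interp_dist[OF X Y that]
    by (simp add: pseudo_struct_space_def interp_obj_def)
  moreover have "interp_obj dX dY \<pi> t \<in> struct_space (lm_dist m) p" if "t \<in> {0<..<1}" for t
    using moments[of t] prob polish_metric_interp_dist[OF pX pY, of t] that
    by (simp add: struct_space_def interp_obj_def)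
  \<comment> \<open>At t = 0 the map keeps the feature of the first point and the distance reduces
    to \<open>dX\<close>, so \<open>fst\<close> supplies the matching point; t = 1 is
    symmetric.\<close>
  moreover have "FGW (lm_dist m) \<alpha> p (interp_obj dX dY \<pi> 0) (dX, \<mu>0) = 0"
    unfolding interp_obj_def \<mu> using assms(2)
    by (intro FGW_distr_eq_0 cont_pseudo_metric_interp_dist X Y \<pi> borel_measurable_interp_map
        borel_measurable_fst)
      (auto simp: interp_map_def interp_dist_def)
  moreover have "FGW (lm_dist m) \<alpha> p (interp_obj dX dY \<pi> 1) (dY, \<mu>1) = 0"
    unfolding interp_obj_def \<mu> using assms(2)
    by (intro FGW_distr_eq_0 cont_pseudo_metric_interp_dist X Y \<pi> borel_measurable_interp_map
        borel_measurable_snd)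
      (auto simp: interp_map_def interp_dist_def)
  moreover have "FGW (lm_dist m) \<alpha> p (interp_obj dX dY \<pi> t) (interp_obj dX dY \<pi> s) \<le>
      ennreal \<bar>t - s\<bar> * FGW (lm_dist m) \<alpha> p (dX, \<mu>0) (dY, \<mu>1)" if "t \<in> {0..1}" "s \<in> {0..1}" for t s
    \<comment> \<open>Here optimality of \<pi> replaces the endpoint distance by the root of its
      cost.\<close>
    unfolding FGW_optimal_coupling[OF assms(7)]
    using assms(1-4) that by (intro FGW_interp_obj_le X Y \<pi>) auto
  ultimately show ?thesis
    unfolding FGW_constant_speed_geodesic_def by blast
qed

end
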